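(* Let $A=P_1-R_1+S_1=P_2-R_2+S_2$ be two convergent double weak splittings of type II of a symmetric nonsingular matrix $A\in\mathbb{R}^{n\times n}$, and for $i=1,2$ let $$\widetilde{\mathbf{W}}_i=\begin{pmatrix}(R_iP_i^{-1})^T & -(S_iP_i^{-1})^T\\ I & 0\end{pmatrix}.$$ If $R_1P_1^{-1}\ge R_2P_2^{-1}$ and $AP_1^{-1}\ge AP_2^{-1}$, then $\rho(\widetilde{\mathbf{W}}_1)\le\rho(\widetilde{\mathbf{W}}_2)<1$.
   Context: Matrix inequalities are entrywise; $\rho$ is the spectral radius; $I$ is the $n\times n$ identity. For a symmetric nonsingular matrix $A\in\mathbb{R}^{n\times n}$, a decomposition $A=P-R+S$ with $P$ nonsingular is a double weak splitting of type II if $RP^{-1}\ge 0$ and $-SP^{-1}\ge 0$. It is convergent if its iteration matrix $\begin{pmatrix}(RP^{-1})^T & -(SP^{-1})^T\\ I & 0\end{pmatrix}$ has spectral radius less than $1$. *)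

theory Defs
  imports "Jordan_Normal_Form.Spectral_Radius" "Jordan_Normal_Form.Gauss_Jordan_Elimination"
begin

text \<open>The order on matrices is the entrywise one of \<^theory>\<open>Jordan_Normal_Form.Matrix\<close>;
  it requires equal dimensions.\<close>

text \<open>\<^const>\<open>mat_inverse\<close> is option-valued, so this is only meaningful for nonsingular
  matrices; see \<open>inv_mat\<close> below.\<close>

definition inv_mat :: "real mat \<Rightarrow> real mat" where
  "inv_mat P = the (mat_inverse P)"

lemma inv_mat:
  assumes P: "P \<in> carrier_mat n n" and inv: "invertible_mat P"
  shows "inv_mat P \<in> carrier_mat n n" "P * inv_mat P = 1\<^sub>m n" "inv_mat P * P = 1\<^sub>m n"
proof -
  from inv obtain B where B: "inverts_mat P B" "inverts_mat B P"
    unfolding invertible_mat_def by auto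
  have PB: "P * B = 1\<^sub>m n" and BP: "B * P = 1\<^sub>m (dim_row B)"
    using B P unfolding inverts_mat_def by auto
  have "dim_col (P * B) = n" "dim_col (B * P) = dim_row B"
    unfolding PB BP by auto
  then have Bc: "B \<in> carrier_mat n n"
    using P by auto
  have "P \<in> Units (ring_mat TYPE(real) n ())"
    unfolding Units_def ring_mat_def using P Bc PB BP by auto
  then have "mat_inverse P \<noteq> None"
    using mat_inverse(1)[OF P, where b="()"] by blast
  then show "inv_mat P \<in> carrier_mat n n" "P * inv_mat P = 1\<^sub>m n" "inv_mat P * P = 1\<^sub>m n"
    using mat_inverse(2)[OF P] unfolding inv_mat_def by auto
qed

text \<open>The eigenvalues of a real matrix are taken over the complex numbers.\<close>

definition real_spectral_radius :: "real mat \<Rightarrow> real" where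
  "real_spectral_radius M = spectral_radius (map_mat complex_of_real M)"

definition double_weak_splitting_II ::
  "nat \<Rightarrow> real mat \<Rightarrow> real mat \<Rightarrow> real mat \<Rightarrow> real mat \<Rightarrow> bool" where
  "double_weak_splitting_II n A P R S \<longleftrightarrow>
     P \<in> carrier_mat n n \<and> R \<in> carrier_mat n n \<and> S \<in> carrier_mat n n \<and>
     A = P - R + S \<and> invertible_mat P \<and>
     R * inv_mat P \<ge> 0\<^sub>m n n \<and> - (S * inv_mat P) \<ge> 0\<^sub>m n n"

definition iteration_mat :: "nat \<Rightarrow> real mat \<Rightarrow> real mat \<Rightarrow> real mat \<Rightarrow> real mat" where
  "iteration_mat n P R S =
     four_block_mat (transpose_mat (R * inv_mat P)) (- transpose_mat (S * inv_mat P))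
                    (1\<^sub>m n) (0\<^sub>m n n)"

definition convergent_double_weak_splitting_II ::
  "nat \<Rightarrow> real mat \<Rightarrow> real mat \<Rightarrow> real mat \<Rightarrow> real mat \<Rightarrow> bool" where
  "convergent_double_weak_splitting_II n A P R S \<longleftrightarrow>
     double_weak_splitting_II n A P R S \<and>
     real_spectral_radius (iteration_mat n P R S) < 1"

end

theory Submission
  imports Defs
begin

text \<open>Write \<open>W\<^sub>i\<close> for the iteration matrix, with block rows \<open>(X\<^sub>i, Y\<^sub>i)\<close> and \<open>(I, 0)\<close>.
  The hypotheses give \<open>X\<^sub>1 \<ge> X\<^sub>2\<close> and, since \<open>A P\<^sub>i\<^sup>-\<^sup>1 = I - (X\<^sub>i + Y\<^sub>i)\<^sup>T\<close>,
  \<open>X\<^sub>1 + Y\<^sub>1 \<le> X\<^sub>2 + Y\<^sub>2\<close>. Let \<open>v\<close> be an eigenvector of \<open>W\<^sub>1\<close> for an eigenvalue of maximal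
  modulus \<open>r\<close>, and let \<open>(x, y)\<close> be its entrywise modulus. The second block row gives
  \<open>x = r y \<le> y\<close>, as \<open>r \<le> 1\<close>. Hence
  \<open>X\<^sub>2 x + Y\<^sub>2 y \<ge> X\<^sub>1 x + Y\<^sub>1 y \<ge> r x\<close>, so that \<open>W\<^sub>2 (x, y) \<ge> r (x, y)\<close>, which forces
  \<open>r \<le> \<rho>(W\<^sub>2)\<close> because a scaling of \<open>W\<^sub>2\<close> with spectral radius below one has bounded powers.\<close>

section \<open>Entrywise estimates for matrix-vector products\<close>

lemma mult_mat_vec_index_sum:
  assumes "M \<in> carrier_mat m n" "v \<in> carrier_vec n" "i < m"
  shows "(M *\<^sub>v v) $ i = (\<Sum>j<n. M $$ (i, j) * v $ j)"
  using assms by (simp add: scalar_prod_def atLeast0LessThan)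

lemma smult_mult_mat_vec:
  fixes M :: "'a :: comm_semiring_0 mat"
  assumes "M \<in> carrier_mat m n" "v \<in> carrier_vec n"
  shows "(c \<cdot>\<^sub>m M) *\<^sub>v v = c \<cdot>\<^sub>v (M *\<^sub>v v)"
  using assms by (intro eq_vecI) auto

lemma zero_mult_mat_vec:
  fixes v :: "'a :: semiring_1 vec"
  assumes "v \<in> carrier_vec n"
  shows "0\<^sub>m m n *\<^sub>v v = 0\<^sub>v m"
  using assms by (intro eq_vecI) auto

lemma mult_mat_vec_mono:
  fixes M :: "real mat"
  assumes M: "M \<in> carrier_mat m n" and M0: "0\<^sub>m m n \<le> M"
    and v: "v \<in> carrier_vec n" and le: "v \<le> w"
  shows "M *\<^sub>v v \<le> M *\<^sub>v w"
proof -
  have w: "w \<in> carrier_vec n"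
    using v le by (intro carrier_vecI) (auto simp: less_eq_vec_def)
  have "(M *\<^sub>v v) $ i \<le> (M *\<^sub>v w) $ i" if "i < m" for i
    unfolding mult_mat_vec_index_sum[OF M v that] mult_mat_vec_index_sum[OF M w that]
    using M M0 v w le that
    by (intro sum_mono mult_left_mono) (auto simp: less_eq_vec_def less_eq_mat_def)
  then show ?thesis
    using M by (auto simp: less_eq_vec_def)
qed

text \<open>The triangle inequality on each row, with the nonnegative entries pulled out of the
  norm. It lets a complex eigenvector be replaced by its entrywise modulus.\<close>

lemma norm_mult_mat_vec_le:
  fixes M :: "real mat" and v :: "complex vec"
  assumes M: "M \<in> carrier_mat m n" and M0: "0\<^sub>m m n \<le> M"
    and v: "v \<in> carrier_vec n" and i: "i < m"
  shows "norm ((map_mat complex_of_real M *\<^sub>v v) $ i) \<le> (M *\<^sub>v map_vec norm v) $ i"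
proof -
  have MC: "map_mat complex_of_real M \<in> carrier_mat m n" and nv: "map_vec norm v \<in> carrier_vec n"
    using M v by auto
  show ?thesis
    unfolding mult_mat_vec_index_sum[OF MC v i] mult_mat_vec_index_sum[OF M nv i]
    using M M0 v i
    by (intro sum_norm_le) (auto simp: norm_mult less_eq_mat_def)
qed

section \<open>Spectral radius of real matrices and a lower bound for it\<close>

lemma real_spectral_radius_eigenvector:
  assumes M: "M \<in> carrier_mat N N" and N: "N > 0"
  obtains \<mu> v where "eigenvector (map_mat complex_of_real M) v \<mu>"
    and "norm \<mu> = real_spectral_radius M"
proof -
  have "map_mat complex_of_real M \<in> carrier_mat N N"
    using M by auto
  from spectral_radius_mem_max(1)[OF this N] show thesis
    using that unfolding real_spectral_radius_def spectrum_def eigenvalue_def by auto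
qed

lemma real_spectral_radius_upper:
  assumes M: "M \<in> carrier_mat N N" and N: "N > 0"
    and ev: "eigenvector (map_mat complex_of_real M) v \<mu>"
  shows "norm \<mu> \<le> real_spectral_radius M"
proof -
  have "map_mat complex_of_real M \<in> carrier_mat N N"
    using M by auto
  from spectral_radius_mem_max(2)[OF this N] show ?thesis
    using ev unfolding real_spectral_radius_def spectrum_def eigenvalue_def by blast
qed

lemma real_spectral_radius_nonneg:
  assumes "M \<in> carrier_mat N N" "N > 0"
  shows "0 \<le> real_spectral_radius M"
  by (rule real_spectral_radius_eigenvector[OF assms]) (metis norm_ge_zero)

text \<open>An eigenvector of \<open>c M\<close> for an eigenvalue of maximal modulus is an
  eigenvector of \<open>M\<close> for that eigenvalue divided by \<open>c\<close>. This one
  inequality suffices for rescaling below.\<close>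

lemma real_spectral_radius_smult:
  fixes c :: real
  assumes M: "M \<in> carrier_mat N N" and N: "N > 0" and c: "c > 0"
  shows "real_spectral_radius (c \<cdot>\<^sub>m M) \<le> c * real_spectral_radius M"
proof -
  let ?h = "map_mat complex_of_real"
  have cM: "c \<cdot>\<^sub>m M \<in> carrier_mat N N"
    using M by auto
  obtain \<mu> v where ev: "eigenvector (?h (c \<cdot>\<^sub>m M)) v \<mu>"
    and eq: "norm \<mu> = real_spectral_radius (c \<cdot>\<^sub>m M)"
    by (rule real_spectral_radius_eigenvector[OF cM N])
  have v: "v \<in> carrier_vec N" "v \<noteq> 0\<^sub>v N" and "?h (c \<cdot>\<^sub>m M) *\<^sub>v v = \<mu> \<cdot>\<^sub>v v"
    using ev M unfolding eigenvector_def by auto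
  moreover have "?h (c \<cdot>\<^sub>m M) = complex_of_real c \<cdot>\<^sub>m ?h M"
    using M by (intro eq_matI) auto
  ultimately have "complex_of_real c \<cdot>\<^sub>v (?h M *\<^sub>v v) = \<mu> \<cdot>\<^sub>v v"
    using M by (simp add: smult_mult_mat_vec[of "?h M" N N])
  then have *: "(complex_of_real c \<cdot>\<^sub>v (?h M *\<^sub>v v)) $ i = (\<mu> \<cdot>\<^sub>v v) $ i" for i
    by simp
  have "?h M *\<^sub>v v = (\<mu> / c) \<cdot>\<^sub>v v"
  proof (rule eq_vecI)
    fix i assume i: "i < dim_vec ((\<mu> / c) \<cdot>\<^sub>v v)"
    then show "(?h M *\<^sub>v v) $ i = ((\<mu> / c) \<cdot>\<^sub>v v) $ i"
      using *[of i] M v c by (simp add: field_simps)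
  qed (use M v in auto)
  then have "eigenvector (?h M) v (\<mu> / c)"
    using v M unfolding eigenvector_def by auto
  from real_spectral_radius_upper[OF M N this] show ?thesis
    using c eq by (simp add: norm_divide field_simps)
qed

text \<open>Only the lower half of the Collatz--Wielandt characterisation is needed, and it does not
  rely on the Perron--Frobenius theorem.\<close>

lemma real_spectral_radius_ge:
  fixes M :: "real mat"
  assumes M: "M \<in> carrier_mat N N" and M0: "0\<^sub>m N N \<le> M"
    and u: "u \<in> carrier_vec N" and u0: "0\<^sub>v N \<le> u" and u_nz: "u \<noteq> 0\<^sub>v N"
    and sub: "r \<cdot>\<^sub>v u \<le> M *\<^sub>v u"
  shows "r \<le> real_spectral_radius M"
proof (rule ccontr)
  let ?h = "map_mat complex_of_real"
  \<comment> \<open>A positive entry of \<open>u\<close>; the geometric growth will be read off in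
    this coordinate.\<close>
  obtain i where i: "i < N" and "u $ i \<noteq> 0"
    using u u_nz by (auto simp: vec_eq_iff)
  then have N: "N > 0" and ui: "u $ i > 0"
    using u0 u by (auto simp: less_eq_vec_def order_less_le)
  assume "\<not> r \<le> real_spectral_radius M"
  then obtain t where t: "real_spectral_radius M < t" "t < r"
    using dense[of "real_spectral_radius M" r] by auto
  with real_spectral_radius_nonneg[OF M N] have t0: "t > 0" by simp
  \<comment> \<open>As \<open>t\<close> lies strictly between the spectral radius and
    \<open>r\<close>, dividing by \<open>t\<close> brings the spectral radius below 1 while
    \<open>u\<close> is still stretched by a factor \<open>q\<close> > 1.\<close>
  define M' where "M' = (1 / t) \<cdot>\<^sub>m M"
  define q where "q = r / t"
  have q: "q > 1"
    using t t0 unfolding q_def by simp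
  have M': "M' \<in> carrier_mat N N" and M'0: "0\<^sub>m N N \<le> M'"
    using M M0 t0 unfolding M'_def by (auto simp: less_eq_mat_def)
  have sub': "q \<cdot>\<^sub>v u \<le> M' *\<^sub>v u"
    using sub M u t0 unfolding q_def M'_def smult_mult_mat_vec[OF M u]
    by (auto simp: less_eq_vec_def field_simps)
  \<comment> \<open>Spectral radius below 1 yields, via the Jordan normal form, one constant
    \<open>c\<close> bounding every entry of every power.\<close>
  have "real_spectral_radius M' < 1"
    using real_spectral_radius_smult[OF M N, of "1 / t"] t t0
    unfolding M'_def by (simp add: order_le_less_trans)
  then obtain c where c: "norm_bound (?h M' ^\<^sub>m k) c" for k
    using spectral_radius_jnf_norm_bound_less_1_upper_triangular[of "?h M'" N] M'
    unfolding real_spectral_radius_def by auto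
  have bound: "(M' ^\<^sub>m k) $$ (i, j) \<le> c" if j: "j < N" for j k
  proof -
    have "?h M' ^\<^sub>m k = ?h (M' ^\<^sub>m k)"
      using of_real_hom.mat_hom_pow[OF M', of k] by (rule sym)
    with c[of k] have "norm (?h (M' ^\<^sub>m k) $$ (i, j)) \<le> c"
      using M' i j by (auto simp: norm_bound_def)
    then show ?thesis
      using M' i j by auto
  qed
  \<comment> \<open>Matrix powers unfold with the new factor on the right, whereas the induction for
    \<open>growth\<close> multiplies by \<open>M'\<close> on the left.\<close>
  have comm: "M' ^\<^sub>m k * M' = M' * M' ^\<^sub>m k" for k
    using M' by (induction k) (auto simp: assoc_mult_mat[of _ N N _ N _ N])
  have growth: "q ^ k \<cdot>\<^sub>v u \<le> M' ^\<^sub>m k *\<^sub>v u" for k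
  proof (induction k)
    case 0
    then show ?case using u M' by simp
  next
    case (Suc k)
    have "q ^ Suc k \<cdot>\<^sub>v u = q ^ k \<cdot>\<^sub>v (q \<cdot>\<^sub>v u)"
      by (simp add: smult_smult_assoc mult.commute)
    also have "\<dots> \<le> q ^ k \<cdot>\<^sub>v (M' *\<^sub>v u)"
      using sub' q by (auto simp: less_eq_vec_def intro!: mult_left_mono)
    also have "\<dots> = M' *\<^sub>v (q ^ k \<cdot>\<^sub>v u)"
      using M' u by (simp add: mult_mat_vec)
    also have "\<dots> \<le> M' *\<^sub>v (M' ^\<^sub>m k *\<^sub>v u)"
      using M' u by (intro mult_mat_vec_mono[OF M' M'0 _ Suc]) auto
    also have "\<dots> = M' ^\<^sub>m Suc k *\<^sub>v u"
      using M' u by (simp add: comm assoc_mult_mat_vec[of _ N N _ N])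
    finally show ?case .
  qed
  \<comment> \<open>Coordinate \<open>i\<close> of \<open>growth\<close> against the uniform bound:
    the right side does not depend on \<open>k\<close>, but \<open>q ^ k\<close> is
    unbounded.\<close>
  have "q ^ k * u $ i \<le> c * (\<Sum>j<N. u $ j)" for k
  proof -
    have Mk: "M' ^\<^sub>m k \<in> carrier_mat N N"
      using M' by auto
    have "q ^ k * u $ i \<le> (M' ^\<^sub>m k *\<^sub>v u) $ i"
      using growth[of k] i u M' by (auto simp: less_eq_vec_def)
    also have "\<dots> = (\<Sum>j<N. (M' ^\<^sub>m k) $$ (i, j) * u $ j)"
      by (rule mult_mat_vec_index_sum[OF Mk u i])
    also have "\<dots> \<le> (\<Sum>j<N. c * u $ j)"
      using bound u0 u by (intro sum_mono mult_right_mono) (auto simp: less_eq_vec_def)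
    finally show ?thesis
      by (simp add: sum_distrib_left)
  qed
  moreover obtain k where "c * (\<Sum>j<N. u $ j) / u $ i < q ^ k"
    using real_arch_pow[OF q] by blast
  ultimately show False
    using ui by (metis not_less pos_divide_less_eq)
qed

section \<open>Comparison of the two block iteration matrices\<close>

text \<open>Passing from index 1 to index 2 removes weight \<open>X\<^sub>1 - X\<^sub>2\<close> from
  x and adds at least as much to y. Since y dominates x, the top block row can only grow.\<close>

lemma real_spectral_radius_companion_mono:
  fixes n :: nat and X\<^sub>1 Y\<^sub>1 X\<^sub>2 Y\<^sub>2 :: "real mat"
  defines "W X Y \<equiv> four_block_mat X Y (1\<^sub>m n) (0\<^sub>m n n)"
  assumes n: "n > 0"
    and X1: "X\<^sub>1 \<in> carrier_mat n n" and Y1: "Y\<^sub>1 \<in> carrier_mat n n"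
    and X2: "X\<^sub>2 \<in> carrier_mat n n" and Y2: "Y\<^sub>2 \<in> carrier_mat n n"
    and X1_nonneg: "0\<^sub>m n n \<le> X\<^sub>1" and Y1_nonneg: "0\<^sub>m n n \<le> Y\<^sub>1"
    and X2_nonneg: "0\<^sub>m n n \<le> X\<^sub>2" and Y2_nonneg: "0\<^sub>m n n \<le> Y\<^sub>2"
    and X_le: "X\<^sub>2 \<le> X\<^sub>1" and sum_le: "X\<^sub>1 + Y\<^sub>1 \<le> X\<^sub>2 + Y\<^sub>2"
    and le_1: "real_spectral_radius (W X\<^sub>1 Y\<^sub>1) \<le> 1"
  shows "real_spectral_radius (W X\<^sub>1 Y\<^sub>1) \<le> real_spectral_radius (W X\<^sub>2 Y\<^sub>2)"
proof -
  let ?h = "map_mat complex_of_real"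
  define r where "r = real_spectral_radius (W X\<^sub>1 Y\<^sub>1)"
  have W1: "W X\<^sub>1 Y\<^sub>1 \<in> carrier_mat (n + n) (n + n)" and W2: "W X\<^sub>2 Y\<^sub>2 \<in> carrier_mat (n + n) (n + n)"
    using X1 Y1 X2 Y2 unfolding W_def by auto
  have W2_nonneg: "0\<^sub>m (n + n) (n + n) \<le> W X\<^sub>2 Y\<^sub>2"
    using X2 Y2 X2_nonneg Y2_nonneg unfolding W_def by (auto simp: less_eq_mat_def)
  obtain \<mu> v where ev: "eigenvector (?h (W X\<^sub>1 Y\<^sub>1)) v \<mu>" and r: "norm \<mu> = r"
    using real_spectral_radius_eigenvector[OF W1] n unfolding r_def by blast
  \<comment> \<open>Convergence enters here: the bound r \<le> 1 turns x = r y into x \<le>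
    y.\<close>
  have r01: "0 \<le> r" "r \<le> 1"
    using norm_ge_zero[of \<mu>] le_1 unfolding r r_def[symmetric] by auto
  have v: "v \<in> carrier_vec (n + n)" "v \<noteq> 0\<^sub>v (n + n)" and eq: "?h (W X\<^sub>1 Y\<^sub>1) *\<^sub>v v = \<mu> \<cdot>\<^sub>v v"
    using ev W1 unfolding eigenvector_def by auto
  define a b where "a = vec_first v n" and "b = vec_last v n"
  have a: "a \<in> carrier_vec n" and b: "b \<in> carrier_vec n" and vab: "v = a @\<^sub>v b"
    using v unfolding a_def b_def by auto
  \<comment> \<open>The embedding into the complex numbers is applied blockwise, so that the
    eigenvalue equation splits into two block rows.\<close>
  have hW: "?h (W X\<^sub>1 Y\<^sub>1) = four_block_mat (?h X\<^sub>1) (?h Y\<^sub>1) (1\<^sub>m n) (0\<^sub>m n n)"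
    using X1 Y1 unfolding W_def by (intro eq_matI) auto
  have "(?h X\<^sub>1 *\<^sub>v a + ?h Y\<^sub>1 *\<^sub>v b) @\<^sub>v (1\<^sub>m n *\<^sub>v a + 0\<^sub>m n n *\<^sub>v b) = ?h (W X\<^sub>1 Y\<^sub>1) *\<^sub>v (a @\<^sub>v b)"
    unfolding hW using X1 Y1 a b by (intro four_block_mat_mult_vec[symmetric]) auto
  also have "\<dots> = (\<mu> \<cdot>\<^sub>v a) @\<^sub>v (\<mu> \<cdot>\<^sub>v b)"
    using eq a b unfolding vab by auto
  finally have top: "?h X\<^sub>1 *\<^sub>v a + ?h Y\<^sub>1 *\<^sub>v b = \<mu> \<cdot>\<^sub>v a"
    and bot: "1\<^sub>m n *\<^sub>v a + 0\<^sub>m n n *\<^sub>v b = \<mu> \<cdot>\<^sub>v b"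
    using X1 Y1 a b by (auto simp: append_vec_eq[of _ n])
  have ab: "a = \<mu> \<cdot>\<^sub>v b"
    using bot a zero_mult_mat_vec[OF b] by simp
  define x y where "x = map_vec norm a" and "y = map_vec norm b"
  have x: "x \<in> carrier_vec n" and y: "y \<in> carrier_vec n"
    using a b unfolding x_def y_def by auto
  have x_nonneg: "0 \<le> x $ j" and xy: "x $ j = r * y $ j" and yx: "x $ j \<le> y $ j" if "j < n" for j
  proof -
    show "0 \<le> x $ j" using that a unfolding x_def by auto
    show eq: "x $ j = r * y $ j"
      using that a b r ab unfolding x_def y_def by (auto simp: norm_mult)
    have "0 \<le> y $ j" using that b unfolding y_def by auto
    then show "x $ j \<le> y $ j"
      using r01 unfolding eq by (simp add: mult_left_le_one_le)
  qed
  have top_le: "r * x $ i \<le> (X\<^sub>2 *\<^sub>v x + Y\<^sub>2 *\<^sub>v y) $ i" if i: "i < n" for i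
  proof -
    have "r * x $ i = norm ((?h X\<^sub>1 *\<^sub>v a + ?h Y\<^sub>1 *\<^sub>v b) $ i)"
      unfolding top using r a i unfolding x_def by (auto simp: norm_mult)
    also have "\<dots> \<le> norm ((?h X\<^sub>1 *\<^sub>v a) $ i) + norm ((?h Y\<^sub>1 *\<^sub>v b) $ i)"
      using X1 Y1 i by (auto intro: norm_triangle_ineq)
    also have "\<dots> \<le> (X\<^sub>1 *\<^sub>v x) $ i + (Y\<^sub>1 *\<^sub>v y) $ i"
      unfolding x_def y_def
      by (intro add_mono norm_mult_mat_vec_le[OF X1 X1_nonneg a i] norm_mult_mat_vec_le[OF Y1 Y1_nonneg b i])
    also have "\<dots> = (\<Sum>j<n. X\<^sub>1 $$ (i, j) * x $ j + Y\<^sub>1 $$ (i, j) * y $ j)"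
      by (simp add: mult_mat_vec_index_sum[OF X1 x i] mult_mat_vec_index_sum[OF Y1 y i] sum.distrib
          del: index_mult_mat_vec)
    also have "\<dots> \<le> (\<Sum>j<n. X\<^sub>2 $$ (i, j) * x $ j + Y\<^sub>2 $$ (i, j) * y $ j)"
    proof (rule sum_mono)
      fix j assume "j \<in> {..<n}"
      then have j: "j < n" by simp
      have d: "0 \<le> X\<^sub>1 $$ (i, j) - X\<^sub>2 $$ (i, j)"
        and e: "X\<^sub>1 $$ (i, j) - X\<^sub>2 $$ (i, j) \<le> Y\<^sub>2 $$ (i, j) - Y\<^sub>1 $$ (i, j)"
        using X_le sum_le X1 Y1 X2 Y2 i j by (auto simp: less_eq_mat_def algebra_simps)
      \<comment> \<open>Product of the two comparisons 0 \<le> \<open>X\<^sub>1 - X\<^sub>2\<close>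
        \<le> \<open>Y\<^sub>2 - Y\<^sub>1\<close> and 0 \<le> x \<le> y.\<close>
      have "(X\<^sub>1 $$ (i, j) - X\<^sub>2 $$ (i, j)) * x $ j \<le> (Y\<^sub>2 $$ (i, j) - Y\<^sub>1 $$ (i, j)) * y $ j"
        using d e x_nonneg[OF j] yx[OF j] by (intro mult_mono) auto
      then show "X\<^sub>1 $$ (i, j) * x $ j + Y\<^sub>1 $$ (i, j) * y $ j
          \<le> X\<^sub>2 $$ (i, j) * x $ j + Y\<^sub>2 $$ (i, j) * y $ j"
        by (simp add: algebra_simps)
    qed
    also have "\<dots> = (X\<^sub>2 *\<^sub>v x) $ i + (Y\<^sub>2 *\<^sub>v y) $ i"
      by (simp add: mult_mat_vec_index_sum[OF X2 x i] mult_mat_vec_index_sum[OF Y2 y i] sum.distrib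
          del: index_mult_mat_vec)
    also have "\<dots> = (X\<^sub>2 *\<^sub>v x + Y\<^sub>2 *\<^sub>v y) $ i"
      using X2 Y2 i by auto
    finally show ?thesis .
  qed
  define z where "z = X\<^sub>2 *\<^sub>v x + Y\<^sub>2 *\<^sub>v y"
  have z: "z \<in> carrier_vec n"
    using X2 Y2 x y unfolding z_def by auto
  have W2_xy: "W X\<^sub>2 Y\<^sub>2 *\<^sub>v (x @\<^sub>v y) = z @\<^sub>v x"
    unfolding W_def z_def using X2 Y2 x y by (subst four_block_mat_mult_vec[of _ n n _ n _ n]) auto
  \<comment> \<open>As the modulus of an eigenvector, this vector is nonnegative and
    nonzero.\<close>
  have norm_v: "x @\<^sub>v y = map_vec norm v"
    unfolding vab x_def y_def using a b by (intro eq_vecI) auto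
  have "r \<le> real_spectral_radius (W X\<^sub>2 Y\<^sub>2)"
  proof (rule real_spectral_radius_ge[OF W2 W2_nonneg])
    show "x @\<^sub>v y \<in> carrier_vec (n + n)" "0\<^sub>v (n + n) \<le> x @\<^sub>v y"
      unfolding norm_v using v by (auto simp: less_eq_vec_def)
    show "x @\<^sub>v y \<noteq> 0\<^sub>v (n + n)"
      unfolding norm_v using v by (auto simp: vec_eq_iff)
    \<comment> \<open>The upper block is \<open>top_le\<close>; the lower one is the equality x = r
      y.\<close>
    show "r \<cdot>\<^sub>v (x @\<^sub>v y) \<le> W X\<^sub>2 Y\<^sub>2 *\<^sub>v (x @\<^sub>v y)"
      unfolding W2_xy using top_le[folded z_def] xy[symmetric] x y z
      by (auto simp: less_eq_vec_def)
  qed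
  then show ?thesis
    unfolding r_def .
qed

theorem theorem3p14:
  fixes n :: nat and A P\<^sub>1 R\<^sub>1 S\<^sub>1 P\<^sub>2 R\<^sub>2 S\<^sub>2 :: "real mat"
  assumes "n > 0"
    and "A \<in> carrier_mat n n"
    and "transpose_mat A = A"
    and "invertible_mat A"
    and "convergent_double_weak_splitting_II n A P\<^sub>1 R\<^sub>1 S\<^sub>1"
    and "convergent_double_weak_splitting_II n A P\<^sub>2 R\<^sub>2 S\<^sub>2"
    and "R\<^sub>1 * inv_mat P\<^sub>1 \<ge> R\<^sub>2 * inv_mat P\<^sub>2"
    and "A * inv_mat P\<^sub>1 \<ge> A * inv_mat P\<^sub>2"
  shows "real_spectral_radius (iteration_mat n P\<^sub>1 R\<^sub>1 S\<^sub>1)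
           \<le> real_spectral_radius (iteration_mat n P\<^sub>2 R\<^sub>2 S\<^sub>2)
         \<and> real_spectral_radius (iteration_mat n P\<^sub>2 R\<^sub>2 S\<^sub>2) < 1"
proof -
  have *: "R * inv_mat P \<in> carrier_mat n n" "S * inv_mat P \<in> carrier_mat n n"
      "0\<^sub>m n n \<le> transpose_mat (R * inv_mat P)" "0\<^sub>m n n \<le> - transpose_mat (S * inv_mat P)"
      "real_spectral_radius (iteration_mat n P R S) < 1"
      "A * inv_mat P = 1\<^sub>m n - R * inv_mat P + S * inv_mat P"
    if "convergent_double_weak_splitting_II n A P R S" for P R S
  proof -
    from that have P: "P \<in> carrier_mat n n" and R: "R \<in> carrier_mat n n" and S: "S \<in> carrier_mat n n"
      and A: "A = P - R + S" and inv: "invertible_mat P"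
      and "0\<^sub>m n n \<le> R * inv_mat P" and "0\<^sub>m n n \<le> - (S * inv_mat P)"
      and "real_spectral_radius (iteration_mat n P R S) < 1"
      unfolding convergent_double_weak_splitting_II_def double_weak_splitting_II_def by auto
    note Pi = inv_mat[OF P inv]
    show "R * inv_mat P \<in> carrier_mat n n" "S * inv_mat P \<in> carrier_mat n n"
      using R S Pi by auto
    show "0\<^sub>m n n \<le> transpose_mat (R * inv_mat P)" "0\<^sub>m n n \<le> - transpose_mat (S * inv_mat P)"
      using \<open>0\<^sub>m n n \<le> R * inv_mat P\<close> \<open>0\<^sub>m n n \<le> - (S * inv_mat P)\<close> R S Pi
      by (auto simp: less_eq_mat_def)
    show "real_spectral_radius (iteration_mat n P R S) < 1" by fact
    \<comment> \<open>Multiply A = P - R + S by the inverse of P on the right.\<close>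
    show "A * inv_mat P = 1\<^sub>m n - R * inv_mat P + S * inv_mat P"
      unfolding A add_mult_distrib_mat[OF minus_carrier_mat[OF R] S Pi(1)]
        minus_mult_distrib_mat[OF P R Pi(1)] Pi(2) ..
  qed
  \<comment> \<open>Cancelling the identity reverses the order, and transposition preserves
    entrywise inequalities.\<close>
  have transpose_le: "transpose_mat B\<^sub>1 + - transpose_mat C\<^sub>1 \<le> transpose_mat B\<^sub>2 + - transpose_mat C\<^sub>2"
    if "B\<^sub>1 \<in> carrier_mat n n" "C\<^sub>1 \<in> carrier_mat n n" "B\<^sub>2 \<in> carrier_mat n n" "C\<^sub>2 \<in> carrier_mat n n"
      and "1\<^sub>m n - B\<^sub>2 + C\<^sub>2 \<le> 1\<^sub>m n - B\<^sub>1 + C\<^sub>1" for B\<^sub>1 C\<^sub>1 B\<^sub>2 C\<^sub>2 :: "real mat"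
    using that by (auto simp: less_eq_mat_def algebra_simps)
  note 1 = *[OF assms(5)] and 2 = *[OF assms(6)]
  have "transpose_mat (R\<^sub>2 * inv_mat P\<^sub>2) \<le> transpose_mat (R\<^sub>1 * inv_mat P\<^sub>1)"
    using assms(7) by (auto simp: less_eq_mat_def)
  moreover have "transpose_mat (R\<^sub>1 * inv_mat P\<^sub>1) + - transpose_mat (S\<^sub>1 * inv_mat P\<^sub>1)
      \<le> transpose_mat (R\<^sub>2 * inv_mat P\<^sub>2) + - transpose_mat (S\<^sub>2 * inv_mat P\<^sub>2)"
    by (rule transpose_le[OF 1(1,2) 2(1,2) assms(8)[unfolded 1(6) 2(6)]])
  ultimately show ?thesis
    using 1 2 assms(1) unfolding iteration_mat_def
    by (auto intro!: real_spectral_radius_companion_mono)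
qed

end
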